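(* Let $h\colon U\to U$ be a diffeomorphism. The anti-symplectic map $\Psi=(\Psi^1,\Psi^2)\colon U\oplus U^\ast\to U\oplus U^\ast$ defined by $$\Psi^1(u,u^\ast)=h(u),\qquad \Psi^2(u,u^\ast)=-u^\ast\circ\big(\mathrm Dh(u)\big)^{-1}$$ is a reversal symmetry for $\phi$ if and only if $$S\circ(h\,\underline\times\, h)=S$$ holds true up to a constant, where $(h\,\underline\times\, h)(u,\underline u)=(h(\underline u),h(u))\in U\oplus\underline U$ denotes the reversal action.
   Context: $U$ is a finite-dimensional real vector space, $V=U\oplus U^\ast$ carries the symplectic form $\omega((u,u^\ast),(v,v^\ast))=u^\ast(v)-v^\ast(u)$, and $\underline V=\underline U\oplus\underline U^\ast$ is a copy of $(V,\omega)$, identified with $V$ where needed. $\phi\colon V\to\underline V$ is a symplectic map with $\phi(0)=0$ that has a generating function $S\colon U\oplus\underline U\to\mathbb R$, i.e. $$\{(v,\phi(v)): v\in V\}=\{(u,\mathrm D_uS(u,\underline u),\underline u,-\mathrm D_{\underline u}S(u,\underline u)):(u,\underline u)\in U\oplus\underline U\}\subset V\oplus\underline V .$$ All maps are local (defined on neighbourhoods of $0$, shrunk if necessary; this is suppressed in the notation). A diffeomorphism $\Psi\colon V\to V$ is anti-symplectic if $\Psi^\ast\omega=-\omega$; an anti-symplectic $\Psi$ is called a reversal symmetry for $\phi$ if $\Psi^{-1}\circ\phi\circ\Psi=\phi^{-1}$. *)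

theory Defs
  imports "HOL-Analysis.Analysis"
begin

text \<open>
  Maps are local: a map is a total HOL function together with an open set on which it is
  considered; its values elsewhere are irrelevant.
\<close>

subsection \<open>Smooth maps and diffeomorphisms\<close>

text \<open>
  Class $C^k$, phrased through iterated directional derivatives: the type of the derivative
  differs from that of the function, so a recursion on the full derivative is not typable.
  On open subsets of a finite-dimensional space this is the usual notion.
\<close>

primrec Ck_on :: "nat \<Rightarrow> 'a::real_normed_vector set \<Rightarrow> ('a \<Rightarrow> 'b::real_normed_vector) \<Rightarrow> bool" where
  "Ck_on 0 A f \<longleftrightarrow> continuous_on A f"
| "Ck_on (Suc k) A f \<longleftrightarrow>
     (\<forall>x\<in>A. f differentiable (at x)) \<and>
     (\<forall>v. Ck_on k A (\<lambda>x. frechet_derivative f (at x) v))"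

definition smooth_on :: "'a::real_normed_vector set \<Rightarrow> ('a \<Rightarrow> 'b::real_normed_vector) \<Rightarrow> bool" where
  "smooth_on A f \<longleftrightarrow> (\<forall>k. Ck_on k A f)"

definition diffeo_on :: "'a::real_normed_vector set \<Rightarrow> ('a \<Rightarrow> 'b::real_normed_vector) \<Rightarrow> bool" where
  "diffeo_on A f \<longleftrightarrow>
     open A \<and> open (f ` A) \<and> inj_on f A \<and> smooth_on A f \<and> smooth_on (f ` A) (inv_into A f)"

subsection \<open>The symplectic vector space\<close>

type_synonym 'a dual = "'a \<Rightarrow>\<^sub>L real"
type_synonym 'a phase = "'a \<times> 'a dual"

definition \<omega> :: "'a::euclidean_space phase \<Rightarrow> 'a phase \<Rightarrow> real" where
  "\<omega> x y = blinfun_apply (snd x) (fst y) - blinfun_apply (snd y) (fst x)"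

definition symplectic_on :: "'a::euclidean_space phase set \<Rightarrow> ('a phase \<Rightarrow> 'a phase) \<Rightarrow> bool" where
  "symplectic_on A \<phi> \<longleftrightarrow> diffeo_on A \<phi> \<and>
     (\<forall>x\<in>A. \<forall>a b.
        \<omega> (frechet_derivative \<phi> (at x) a) (frechet_derivative \<phi> (at x) b) = \<omega> a b)"

definition anti_symplectic_on :: "'a::euclidean_space phase set \<Rightarrow> ('a phase \<Rightarrow> 'a phase) \<Rightarrow> bool" where
  "anti_symplectic_on A \<Psi> \<longleftrightarrow> diffeo_on A \<Psi> \<and>
     (\<forall>x\<in>A. \<forall>a b.
        \<omega> (frechet_derivative \<Psi> (at x) a) (frechet_derivative \<Psi> (at x) b) = - \<omega> a b)"

subsection \<open>Generating functions\<close>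

definition D1 :: "('a::euclidean_space \<times> 'a \<Rightarrow> real) \<Rightarrow> 'a \<Rightarrow> 'a \<Rightarrow> 'a dual" where
  "D1 S u u' = Blinfun (frechet_derivative (\<lambda>x. S (x, u')) (at u))"

definition D2 :: "('a::euclidean_space \<times> 'a \<Rightarrow> real) \<Rightarrow> 'a \<Rightarrow> 'a \<Rightarrow> 'a dual" where
  "D2 S u u' = Blinfun (frechet_derivative (\<lambda>x. S (u, x)) (at u'))"

definition generating_function ::
  "('a::euclidean_space \<times> 'a) set \<Rightarrow> ('a \<times> 'a \<Rightarrow> real) \<Rightarrow>
   'a phase set \<Rightarrow> ('a phase \<Rightarrow> 'a phase) \<Rightarrow> bool" where
  "generating_function W S A \<phi> \<longleftrightarrow> open W \<and> smooth_on W S \<and>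
     {(v, \<phi> v) | v. v \<in> A} =
     {((u, D1 S u u'), (u', - D2 S u u')) | u u'. (u, u') \<in> W}"

subsection \<open>Reversal symmetries\<close>

text \<open>
  The equation $\Psi^{-1} \circ \phi \circ \Psi = \phi^{-1}$ is meant near 0. The membership
  conditions say that both sides are defined.
\<close>

definition reversal_symmetry ::
  "'a::euclidean_space phase set \<Rightarrow> ('a phase \<Rightarrow> 'a phase) \<Rightarrow>
   'a phase set \<Rightarrow> ('a phase \<Rightarrow> 'a phase) \<Rightarrow> bool" where
  "reversal_symmetry C \<Psi> A \<phi> \<longleftrightarrow> anti_symplectic_on C \<Psi> \<and>
     (\<forall>\<^sub>F v in nhds 0.
        v \<in> C \<and> \<Psi> v \<in> A \<and> \<phi> (\<Psi> v) \<in> \<Psi> ` C \<and> v \<in> \<phi> ` A \<and>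
        inv_into C \<Psi> (\<phi> (\<Psi> v)) = inv_into A \<phi> v)"

definition reversal_lift :: "('a::euclidean_space \<Rightarrow> 'a) \<Rightarrow> 'a phase \<Rightarrow> 'a phase" where
  "reversal_lift h = (\<lambda>(u, p). (h u, - (p o\<^sub>L Blinfun (inv (frechet_derivative h (at u))))))"

definition reversal_action :: "('a \<Rightarrow> 'a) \<Rightarrow> 'a \<times> 'a \<Rightarrow> 'a \<times> 'a" where
  "reversal_action h = (\<lambda>(u, u'). (h u', h u))"

end

theory Submission
  imports Defs
begin

text \<open>
  On the open image of $h$ put $g = h^{-1}$, so that $\Psi(u, p) = (h(u), - p \circ Dg(h(u)))$.
  The inverse of $\Psi$ is the same construction for $g$, hence smooth, and $\Psi$ is anti-symplectic
  because $D^2 g$ is symmetric.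

  Write $v = (u, D_u S)$ and $\phi(v) = (u', - D_{u'} S)$. Near 0, $\Psi$ is a reversal symmetry iff
  $\phi(\Psi(\phi(v))) = \Psi(v)$, i.e. iff $(\Psi(\phi(v)), \Psi(v))$ lies on the graph of $\phi$. In terms
  of $S$ this says that $S(h(u'), h(u))$ and $S(u, u')$ have the same derivative at every $(u, u')$
  near 0, so that they differ by a constant. The point $h(0)$ may differ from 0, since only values of
  $S$ near $(h(0), h(0))$ enter on the left.
\<close>

section \<open>Calculus of $C^k$ maps\<close>

lemma Ck_on_cong:
  fixes f g :: "'a::real_normed_vector \<Rightarrow> 'b::real_normed_vector"
  assumes "open A" "\<And>x. x \<in> A \<Longrightarrow> f x = g x"
  shows "Ck_on k A f \<longleftrightarrow> Ck_on k A g"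
  using assms(2)
proof (induction k arbitrary: f g)
  case 0
  then show ?case by (auto cong: continuous_on_cong)
next
  case (Suc k)
  have der: "(f has_derivative D) (at x) \<longleftrightarrow> (g has_derivative D) (at x)" if "x \<in> A" for x D
    using has_derivative_transform_within_open[OF _ \<open>open A\<close> that] Suc.prems by metis
  then have diff: "f differentiable (at x) \<longleftrightarrow> g differentiable (at x)" if "x \<in> A" for x
    using that by (auto simp: differentiable_def)
  \<comment> \<open>\<open>frechet_derivative\<close> chooses among the maps satisfying
    \<open>has_derivative\<close>. Since that predicate is the same for both functions at
    \<open>x\<close>, so is the chosen map.\<close>
  have "frechet_derivative f (at x) = frechet_derivative g (at x)" if "x \<in> A" for x
    using der[OF that] by (simp add: frechet_derivative_def)
  then have "Ck_on k A (\<lambda>x. frechet_derivative f (at x) v)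
      \<longleftrightarrow> Ck_on k A (\<lambda>x. frechet_derivative g (at x) v)" for v
    by (intro Suc.IH) simp
  with diff show ?case by auto
qed

text \<open>Raises the regularity from an explicit derivative formula. The formula agrees with
  \<open>frechet_derivative\<close> only on \<open>A\<close>, and openness of \<open>A\<close> keeps
  this mismatch outside from mattering to further derivatives.\<close>

lemma Ck_on_SucI:
  assumes "open A" "\<And>x. x \<in> A \<Longrightarrow> (f has_derivative f' x) (at x)"
    and "\<And>v. Ck_on k A (\<lambda>x. f' x v)"
  shows "Ck_on (Suc k) A f"
proof -
  have "frechet_derivative f (at x) = f' x" if "x \<in> A" for x
    using assms(2)[OF that] frechet_derivative_at by metis
  then have "Ck_on k A (\<lambda>x. frechet_derivative f (at x) v)" for v
    using Ck_on_cong[OF assms(1), of "\<lambda>x. frechet_derivative f (at x) v" "\<lambda>x. f' x v"] assms(3)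
    by simp
  then show ?thesis
    using assms(2) by (auto simp: differentiable_def)
qed

lemma Ck_on_has_derivative:
  "Ck_on (Suc k) A f \<Longrightarrow> x \<in> A \<Longrightarrow> (f has_derivative frechet_derivative f (at x)) (at x)"
  by (simp add: frechet_derivative_works[symmetric])

lemma Ck_on_imp_continuous_on: "Ck_on k A f \<Longrightarrow> continuous_on A f"
  by (cases k) (auto intro!: continuous_at_imp_continuous_on differentiable_imp_continuous_within)

lemma Ck_on_SucD: "Ck_on (Suc k) A f \<Longrightarrow> Ck_on k A f"
proof (induction k arbitrary: f)
  case 0
  then show ?case using Ck_on_imp_continuous_on by (metis Ck_on.simps(1))
qed simp

lemma Ck_on_const: "open A \<Longrightarrow> Ck_on k A (\<lambda>x. c)"
proof (induction k arbitrary: c)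
  case (Suc k)
  then show ?case by simp
qed simp

lemma Ck_on_bounded_linear:
  assumes "bounded_linear L" "open A" "Ck_on k A f"
  shows "Ck_on k A (\<lambda>x. L (f x))"
  using assms(3)
proof (induction k arbitrary: f)
  case 0
  then show ?case
    using bounded_linear.continuous_on[OF assms(1)] by simp
next
  case (Suc k)
  show ?case
  proof (rule Ck_on_SucI)
    show "((\<lambda>x. L (f x)) has_derivative (\<lambda>v. L (frechet_derivative f (at x) v))) (at x)"
      if "x \<in> A" for x
      by (intro bounded_linear.has_derivative[OF assms(1)] Ck_on_has_derivative[OF Suc.prems] that)
  qed (use Suc assms(2) in auto)
qed

text \<open>A linear inner map carries the fixed direction \<open>v\<close> to the fixed direction
  \<open>L v\<close>. The derivative of the composite is therefore a directional derivative of
  \<open>f\<close> composed with \<open>L\<close>, and the induction closes without a basis. This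
  serves the projections from the phase space, whose dual factor is merely a normed space.\<close>

lemma Ck_on_compose_linear:
  assumes "bounded_linear L" "open A" "Ck_on k A f"
  shows "Ck_on k (L -` A) (\<lambda>x. f (L x))"
  using assms(3)
proof (induction k arbitrary: f)
  case 0
  then show ?case
    using linear_continuous_on[OF assms(1)]
    by (auto intro!: continuous_on_compose2[of A f _ L])
next
  case (Suc k)
  show ?case
  proof (rule Ck_on_SucI)
    show "((\<lambda>x. f (L x)) has_derivative (\<lambda>v. frechet_derivative f (at (L x)) (L v))) (at x)"
      if "x \<in> L -` A" for x
      using that
      by (intro has_derivative_compose[OF bounded_linear_imp_has_derivative[OF assms(1)]]
          Ck_on_has_derivative[OF Suc.prems]) auto
    show "open (L -` A)"
      using assms(1,2) linear_continuous_on[OF assms(1), of UNIV] open_vimage by blast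
    show "Ck_on k (L -` A) (\<lambda>x. frechet_derivative f (at (L x)) (L v))" for v
      using Suc.IH[of "\<lambda>x. frechet_derivative f (at x) (L v)"] Suc.prems by simp
  qed
qed

lemma Ck_on_add:
  assumes "open A" "Ck_on k A f" "Ck_on k A g"
  shows "Ck_on k A (\<lambda>x. f x + g x)"
  using assms(2,3)
proof (induction k arbitrary: f g)
  case 0
  then show ?case by (auto intro: continuous_on_add)
next
  case (Suc k)
  show ?case
  proof (rule Ck_on_SucI)
    show "((\<lambda>x. f x + g x) has_derivative
        (\<lambda>v. frechet_derivative f (at x) v + frechet_derivative g (at x) v)) (at x)"
      if "x \<in> A" for x
      using that by (intro has_derivative_add Ck_on_has_derivative[OF Suc.prems(1)]
          Ck_on_has_derivative[OF Suc.prems(2)])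
  qed (use Suc assms(1) in auto)
qed

lemma Ck_on_sum:
  assumes "open A" "finite I" "\<And>i. i \<in> I \<Longrightarrow> Ck_on k A (f i)"
  shows "Ck_on k A (\<lambda>x. \<Sum>i\<in>I. f i x)"
  using assms(2,3) by (induction I) (auto intro: Ck_on_add[OF assms(1)] Ck_on_const[OF assms(1)])

lemma (in bounded_bilinear) Ck_on:
  assumes "open A" "Ck_on k A f" "Ck_on k A g"
  shows "Ck_on k A (\<lambda>x. prod (f x) (g x))"
  using assms(2,3)
proof (induction k arbitrary: f g)
  case 0
  then show ?case by (auto intro: continuous_on)
next
  case (Suc k)
  show ?case
  proof (rule Ck_on_SucI)
    show "((\<lambda>x. prod (f x) (g x)) has_derivative
        (\<lambda>v. prod (f x) (frechet_derivative g (at x) v) + prod (frechet_derivative f (at x) v) (g x))) (at x)"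
      if "x \<in> A" for x
      by (rule FDERIV[OF Ck_on_has_derivative[OF Suc.prems(1) that]
            Ck_on_has_derivative[OF Suc.prems(2) that]])
    show "Ck_on k A (\<lambda>x. prod (f x) (frechet_derivative g (at x) v) + prod (frechet_derivative f (at x) v) (g x))"
      for v
      using Suc.prems Ck_on_SucD[OF Suc.prems(1)] Ck_on_SucD[OF Suc.prems(2)]
      by (intro Ck_on_add[OF assms(1)] Suc.IH) auto
  qed (fact assms(1))
qed

lemma Ck_on_Pair:
  assumes "open A" "Ck_on k A f" "Ck_on k A g"
  shows "Ck_on k A (\<lambda>x. (f x, g x))"
proof -
  have "Ck_on k A (\<lambda>x. (f x, 0) + (0, g x))"
    by (intro Ck_on_add[OF assms(1)] Ck_on_bounded_linear[OF _ assms(1), where L = "\<lambda>y. (y, 0)"]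
        Ck_on_bounded_linear[OF _ assms(1), where L = "Pair 0"] assms(2,3)
        bounded_linear_Pair bounded_linear_ident bounded_linear_zero)
  then show ?thesis by simp
qed

text \<open>Trades a varying direction for the finitely many fixed directions in
  \<open>Basis\<close>; \<open>Ck_on\<close> speaks only about fixed directions.\<close>

lemma linear_euclidean_expansion:
  fixes L :: "'a::euclidean_space \<Rightarrow> 'b::real_vector"
  assumes "linear L"
  shows "L v = (\<Sum>i\<in>Basis. (v \<bullet> i) *\<^sub>R L i)"
  by (metis (mono_tags, lifting) assms euclidean_representation linear_scale linear_sum sum.cong)

text \<open>In the chain rule both the base point and the direction fed to the derivative of
  \<open>g\<close> depend on \<open>x\<close>. Expanding the direction in a basis gives a sum of
  products of a coordinate of the derivative of \<open>f\<close> with a directional derivative of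
  \<open>g\<close> along a fixed basis vector, composed with \<open>f\<close>. The induction
  hypothesis covers the second factor.\<close>

lemma Ck_on_compose:
  fixes f :: "'a::real_normed_vector \<Rightarrow> 'b::euclidean_space" and g :: "'b \<Rightarrow> 'c::real_normed_vector"
  assumes "open A" "f ` A \<subseteq> B" "Ck_on k A f" "Ck_on k B g"
  shows "Ck_on k A (\<lambda>x. g (f x))"
  using assms(3,4)
proof (induction k arbitrary: g)
  case 0
  then show ?case using assms(2) by (auto intro: continuous_on_compose2)
next
  case (Suc k)
  have der: "((\<lambda>x. g (f x)) has_derivative
      (\<lambda>v. frechet_derivative g (at (f x)) (frechet_derivative f (at x) v))) (at x)"
    if "x \<in> A" for x
    by (rule has_derivative_compose[OF Ck_on_has_derivative[OF Suc.prems(1) that]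
          Ck_on_has_derivative[OF Suc.prems(2)]])
      (use that assms(2) in auto)
  have expand: "frechet_derivative g (at (f x)) w =
      (\<Sum>i\<in>Basis. (w \<bullet> i) *\<^sub>R frechet_derivative g (at (f x)) i)" if "x \<in> A" for x w
    by (rule linear_euclidean_expansion[OF linear_frechet_derivative])
      (use that assms(2) Suc.prems(2) in auto)
  show ?case
  proof (rule Ck_on_SucI)
    show "((\<lambda>x. g (f x)) has_derivative (\<lambda>v. \<Sum>i\<in>Basis. (frechet_derivative f (at x) v \<bullet> i) *\<^sub>R
        frechet_derivative g (at (f x)) i)) (at x)" if "x \<in> A" for x
    proof -
      have "(\<lambda>v. \<Sum>i\<in>Basis. (frechet_derivative f (at x) v \<bullet> i) *\<^sub>R
          frechet_derivative g (at (f x)) i) =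
        (\<lambda>v. frechet_derivative g (at (f x)) (frechet_derivative f (at x) v))"
        by (rule ext, rule expand[OF that, symmetric])
      with der[OF that] show ?thesis by simp
    qed
    show "Ck_on k A (\<lambda>x. \<Sum>i\<in>Basis. (frechet_derivative f (at x) v \<bullet> i) *\<^sub>R
        frechet_derivative g (at (f x)) i)" for v
    proof (intro Ck_on_sum bounded_bilinear.Ck_on[OF bounded_bilinear_scaleR] assms(1))
      show "Ck_on k A (\<lambda>x. frechet_derivative f (at x) v \<bullet> i)" for i
        using Suc.prems(1)
        by (intro Ck_on_bounded_linear[OF bounded_linear_inner_left] assms(1)) simp
      show "Ck_on k A (\<lambda>x. frechet_derivative g (at (f x)) i)" for i
        using Suc.prems Ck_on_SucD by (intro Suc.IH) auto
    qed simp
  qed (fact assms(1))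
qed

text \<open>Makes smoothness of an operator-valued expression accessible: with \<open>L\<close> a
  derivative, the right-hand side involves only its directional values \<open>L i\<close>.\<close>

lemma blinfun_euclidean_expansion:
  fixes L :: "'a::euclidean_space \<Rightarrow>\<^sub>L 'b::real_normed_vector" and p :: "'b dual"
  shows "p o\<^sub>L L = (\<Sum>i\<in>Basis. p (L i) *\<^sub>R blinfun_inner_right i)"
proof (rule blinfun_eqI)
  fix v
  show "(p o\<^sub>L L) v = (\<Sum>i\<in>Basis. p (L i) *\<^sub>R blinfun_inner_right i) v"
    using linear_euclidean_expansion[of "blinfun_apply (p o\<^sub>L L)" v]
    by (simp add: blinfun.sum_left blinfun.scaleR_left mult.commute inner_commute
        blinfun.bounded_linear_right bounded_linear.linear)
qed

section \<open>Symmetry of second derivatives\<close>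

text \<open>Two applications of the mean value theorem, first along \<open>a\<close> and then along
  \<open>b\<close>, turn the quotient into the mixed derivative at an intermediate point of the
  parallelogram spanned by \<open>t a\<close> and \<open>t b\<close>. Continuity of this mixed
  derivative gives the limit.\<close>

lemma second_difference_tendsto:
  fixes f :: "'a::real_normed_vector \<Rightarrow> real"
  assumes "open A" "x \<in> A"
    and f': "\<And>y. y \<in> A \<Longrightarrow> (f has_derivative f' y) (at y)"
    and f2: "\<And>y. y \<in> A \<Longrightarrow> ((\<lambda>y. f' y a) has_derivative f2 y) (at y)"
    and cont: "continuous_on A (\<lambda>y. f2 y b)"
  shows "((\<lambda>t. (f (x + t *\<^sub>R a + t *\<^sub>R b) - f (x + t *\<^sub>R a) - f (x + t *\<^sub>R b) + f x) / t\<^sup>2)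
    \<longlongrightarrow> f2 x b) (at_right 0)"
proof (rule tendstoI)
  fix e :: real assume "e > 0"
  have "isCont (\<lambda>y. f2 y b) x"
    using cont assms(1,2) continuous_on_eq_continuous_at by blast
  then obtain d1 where d1: "d1 > 0" "\<And>y. dist y x < d1 \<Longrightarrow> dist (f2 y b) (f2 x b) < e"
    using \<open>e > 0\<close> unfolding continuous_at_eps_delta by (metis dist_real_def dist_norm)
  obtain d2 where d2: "d2 > 0" "ball x d2 \<subseteq> A"
    using assms(1,2) open_contains_ball by blast
  \<comment> \<open>For \<open>t < d\<close> the whole parallelogram lies in the ball of radius
    \<open>min d1 d2\<close>. The summand 1 keeps the denominator positive when \<open>a\<close> and
    \<open>b\<close> both vanish.\<close>
  define d where "d = min d1 d2 / (norm a + norm b + 1)"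
  have pos: "norm a + norm b + 1 > 0"
    by (smt (verit) norm_ge_zero)
  then have "d > 0"
    using d1(1) d2(1) by (simp add: d_def)
  have near: "dist (x + s *\<^sub>R a + r *\<^sub>R b) x < min d1 d2"
    if "0 \<le> s" "s \<le> t" "0 \<le> r" "r \<le> t" "0 < t" "t < d" for s r t
  proof -
    have "dist (x + s *\<^sub>R a + r *\<^sub>R b) x \<le> norm (s *\<^sub>R a) + norm (r *\<^sub>R b)"
      using norm_triangle_ineq[of "s *\<^sub>R a" "r *\<^sub>R b"] by (simp add: dist_norm add.assoc)
    also have "\<dots> \<le> t * norm a + t * norm b"
      using that by (auto intro!: add_mono mult_right_mono)
    also have "\<dots> < t * (norm a + norm b + 1)"
      using that by (simp add: algebra_simps)
    also have "\<dots> < d * (norm a + norm b + 1)"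
      using that pos by (intro mult_strict_right_mono)
    also have "\<dots> = min d1 d2"
      using pos by (simp add: d_def)
    finally show ?thesis .
  qed
  have inA: "x + s *\<^sub>R a + r *\<^sub>R b \<in> A"
    if "0 \<le> s" "s \<le> t" "0 \<le> r" "r \<le> t" "0 < t" "t < d" for s r t
    using near[OF that] d2(2) by (auto simp: dist_commute subset_iff)
  have "dist ((f (x + t *\<^sub>R a + t *\<^sub>R b) - f (x + t *\<^sub>R a) - f (x + t *\<^sub>R b) + f x) / t\<^sup>2) (f2 x b) < e"
    if t: "0 < t" "t < d" for t
  proof -
    let ?q = "\<lambda>s r. x + s *\<^sub>R a + r *\<^sub>R b"
    have da: "((\<lambda>s. f (?q s r)) has_real_derivative f' (?q s r) a) (at s)"
      if "0 \<le> s" "s \<le> t" "0 \<le> r" "r \<le> t" for s r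
    proof -
      have lin: "linear (f' (?q s r))"
        using f'[OF inA[OF that t]] has_derivative_linear by blast
      have "((\<lambda>s. f (?q s r)) has_derivative (\<lambda>u. f' (?q s r) (u *\<^sub>R a))) (at s)"
        by (rule has_derivative_compose[where f = "\<lambda>s. ?q s r" and x = s, OF _ f'[OF inA[OF that t]]])
           (auto intro!: derivative_eq_intros)
      then show ?thesis
        by (simp add: has_field_derivative_def linear_scale[OF lin] mult_commute_abs)
    qed
    have db: "((\<lambda>r. f' (?q s r) a) has_real_derivative f2 (?q s r) b) (at r)"
      if "0 \<le> s" "s \<le> t" "0 \<le> r" "r \<le> t" for s r
    proof -
      have lin: "linear (f2 (?q s r))"
        using f2[OF inA[OF that t]] has_derivative_linear by blast
      have "((\<lambda>r. f' (?q s r) a) has_derivative (\<lambda>u. f2 (?q s r) (u *\<^sub>R b))) (at r)"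
        by (rule has_derivative_compose[where f = "\<lambda>r. ?q s r" and x = r, OF _ f2[OF inA[OF that t]]])
           (auto intro!: derivative_eq_intros)
      then show ?thesis
        by (simp add: has_field_derivative_def linear_scale[OF lin] mult_commute_abs)
    qed
    \<comment> \<open>The function \<open>f (?q s t) - f (?q s 0)\<close> of \<open>s\<close> has
      the second difference as its increment from 0 to \<open>t\<close>.\<close>
    obtain s where s: "0 < s" "s < t" and
      "(f (?q t t) - f (?q t 0)) - (f (?q 0 t) - f (?q 0 0)) =
        (t - 0) * (f' (?q s t) a - f' (?q s 0) a)"
      using MVT2[OF t(1), of "\<lambda>s. f (?q s t) - f (?q s 0)" "\<lambda>s. f' (?q s t) a - f' (?q s 0) a"]
        DERIV_diff[OF da[of _ t] da[of _ 0]] t by auto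
    moreover obtain r where r: "0 < r" "r < t" and
      "f' (?q s t) a - f' (?q s 0) a = (t - 0) * f2 (?q s r) b"
      using MVT2[OF t(1), of "\<lambda>r. f' (?q s r) a" "\<lambda>r. f2 (?q s r) b"] db s by auto
    ultimately have "(f (x + t *\<^sub>R a + t *\<^sub>R b) - f (x + t *\<^sub>R a) - f (x + t *\<^sub>R b) + f x) / t\<^sup>2
        = f2 (?q s r) b"
      using t(1) by (simp add: power2_eq_square field_simps)
    then show ?thesis
      using d1(2) near[of s t r] s r t by simp
  qed
  then show "\<forall>\<^sub>F t in at_right 0.
      dist ((f (x + t *\<^sub>R a + t *\<^sub>R b) - f (x + t *\<^sub>R a) - f (x + t *\<^sub>R b) + f x) / t\<^sup>2) (f2 x b) < e"
    using \<open>d > 0\<close> by (auto simp: eventually_at_right_field)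
qed

text \<open>The second difference quotient is unchanged when \<open>a\<close> and \<open>b\<close>
  are swapped, and both mixed derivatives are its limit.\<close>

lemma second_derivative_symmetric_real:
  fixes f :: "'a::real_normed_vector \<Rightarrow> real"
  assumes "open A" "Ck_on 2 A f" "x \<in> A"
  shows "frechet_derivative (\<lambda>y. frechet_derivative f (at y) a) (at x) b =
    frechet_derivative (\<lambda>y. frechet_derivative f (at y) b) (at x) a"
proof -
  have C2: "Ck_on (Suc (Suc 0)) A f"
    using assms(2) by (simp only: numeral_2_eq_2)
  have C1: "Ck_on (Suc 0) A (\<lambda>y. frechet_derivative f (at y) c)" for c
    using C2 by (subst (asm) Ck_on.simps(2)) blast
  let ?T = "\<lambda>a b. ((\<lambda>t. (f (x + t *\<^sub>R a + t *\<^sub>R b) - f (x + t *\<^sub>R a) - f (x + t *\<^sub>R b) + f x) / t\<^sup>2)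
    \<longlongrightarrow> frechet_derivative (\<lambda>y. frechet_derivative f (at y) a) (at x) b) (at_right 0)"
  have T: "?T a b" for a b
    using C1[of a]
    by (intro second_difference_tendsto[OF assms(1,3) Ck_on_has_derivative[OF C2]]
        Ck_on_has_derivative[OF C1]) auto
  show ?thesis
    using tendsto_unique[OF _ T[of a b]] T[of b a] by (simp add: algebra_simps)
qed

text \<open>Taking the inner product with a basis vector commutes with differentiation, which
  reduces the claim to the real-valued case.\<close>

lemma second_derivative_symmetric:
  fixes f :: "'a::real_normed_vector \<Rightarrow> 'b::euclidean_space"
  assumes "open A" "Ck_on 2 A f" "x \<in> A"
  shows "frechet_derivative (\<lambda>y. frechet_derivative f (at y) a) (at x) b =
    frechet_derivative (\<lambda>y. frechet_derivative f (at y) b) (at x) a"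
proof (rule euclidean_eqI)
  fix i :: 'b
  have C2: "Ck_on (Suc (Suc 0)) A f"
    using assms(2) by (simp only: numeral_2_eq_2)
  have C1: "Ck_on (Suc 0) A (\<lambda>y. frechet_derivative f (at y) c)" for c
    using C2 by (subst (asm) Ck_on.simps(2)) blast
  have 1: "frechet_derivative (\<lambda>y. f y \<bullet> i) (at y) c = frechet_derivative f (at y) c \<bullet> i"
    if "y \<in> A" for y c
    using has_derivative_inner_left[OF Ck_on_has_derivative[OF C2 that], of i]
    by (metis frechet_derivative_at)
  have 2: "frechet_derivative (\<lambda>y. frechet_derivative (\<lambda>y. f y \<bullet> i) (at y) c) (at x) d =
      frechet_derivative (\<lambda>y. frechet_derivative f (at y) c) (at x) d \<bullet> i" for c d
  proof -
    have "((\<lambda>y. frechet_derivative (\<lambda>y. f y \<bullet> i) (at y) c) has_derivative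
        (\<lambda>d. frechet_derivative (\<lambda>y. frechet_derivative f (at y) c) (at x) d \<bullet> i)) (at x)"
      by (rule has_derivative_transform_within_open[OF
            has_derivative_inner_left[OF Ck_on_has_derivative[OF C1 assms(3)]] assms(1,3)])
         (simp add: 1)
    then show ?thesis by (metis frechet_derivative_at)
  qed
  show "frechet_derivative (\<lambda>y. frechet_derivative f (at y) a) (at x) b \<bullet> i =
    frechet_derivative (\<lambda>y. frechet_derivative f (at y) b) (at x) a \<bullet> i"
    using second_derivative_symmetric_real[OF assms(1)
        Ck_on_bounded_linear[OF bounded_linear_inner_left assms(1,2)] assms(3), of i a b]
    by (simp add: 2)
qed


section \<open>Diffeomorphisms and the lift of a reversal\<close>

lemma smooth_on_cong:
  assumes "open A" "\<And>x. x \<in> A \<Longrightarrow> f x = g x"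
  shows "smooth_on A f \<longleftrightarrow> smooth_on A g"
  using Ck_on_cong[OF assms] by (simp add: smooth_on_def)

lemma smooth_on_has_derivative:
  "smooth_on A f \<Longrightarrow> x \<in> A \<Longrightarrow> (f has_derivative frechet_derivative f (at x)) (at x)"
  using Ck_on_has_derivative unfolding smooth_on_def by blast

lemma smooth_on_imp_continuous_on: "smooth_on A f \<Longrightarrow> continuous_on A f"
  using Ck_on_imp_continuous_on unfolding smooth_on_def by blast

lemma smooth_on_frechet_derivative:
  "smooth_on A f \<Longrightarrow> smooth_on A (\<lambda>x. frechet_derivative f (at x) v)"
  unfolding smooth_on_def using Ck_on.simps(2) by blast

lemma Ck_on_ident: "open A \<Longrightarrow> Ck_on k A (\<lambda>x. x)"
proof (cases k)
  case (Suc m)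
  assume "open A"
  then show ?thesis
    unfolding Suc by (rule Ck_on_SucI) (auto intro: Ck_on_const has_derivative_ident \<open>open A\<close>)
qed simp

text \<open>Lets smoothness of the inverse be checked on an explicit formula \<open>g\<close>
  instead of \<open>inv_into\<close>; the two agree on the open image.\<close>

lemma diffeo_onI:
  assumes "open A" "open B" "\<And>x. x \<in> A \<Longrightarrow> f x \<in> B" "\<And>y. y \<in> B \<Longrightarrow> g y \<in> A"
    and "\<And>x. x \<in> A \<Longrightarrow> g (f x) = x" "\<And>y. y \<in> B \<Longrightarrow> f (g y) = y"
    and "smooth_on A f" "smooth_on B g"
  shows "diffeo_on A f"
proof -
  have inj: "inj_on f A"
    using assms(5) by (rule inj_on_inverseI)
  have im: "f ` A = B"
    using assms(3,4,6) by (auto intro!: rev_image_eqI)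
  have "inv_into A f y = g y" if "y \<in> B" for y
    using inv_into_f_eq[OF inj] assms(4,6) that by blast
  then have "smooth_on B (inv_into A f)"
    using smooth_on_cong[OF assms(2)] assms(8) by metis
  then show ?thesis
    using assms(1,2,7) inj im by (simp add: diffeo_on_def)
qed

text \<open>Both inverse relations hold on open sets, so the chain rule applied to them, together
  with uniqueness of the derivative of the identity, gives the two equations.\<close>

lemma diffeo_on_derivative_inverse:
  assumes "diffeo_on A f" "x \<in> A"
  shows "frechet_derivative (inv_into A f) (at (f x)) (frechet_derivative f (at x) v) = v"
    and "frechet_derivative f (at x) (frechet_derivative (inv_into A f) (at (f x)) w) = w"
proof -
  let ?g = "inv_into A f"
  have A: "open A" "open (f ` A)" "inj_on f A" "smooth_on A f" "smooth_on (f ` A) ?g"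
    using assms(1) by (auto simp: diffeo_on_def)
  note Df = smooth_on_has_derivative[OF A(4) assms(2)]
  have fx: "f x \<in> f ` A" "?g (f x) = x"
    using assms(2) A(3) by auto
  note Dg = smooth_on_has_derivative[OF A(5) fx(1)]
  have "((\<lambda>x. x) has_derivative
      (\<lambda>v. frechet_derivative ?g (at (f x)) (frechet_derivative f (at x) v))) (at x)"
    by (rule has_derivative_transform_within_open[OF has_derivative_compose[OF Df Dg] A(1) assms(2)])
       (simp add: A(3))
  from has_derivative_unique[OF this has_derivative_ident]
  show "frechet_derivative ?g (at (f x)) (frechet_derivative f (at x) v) = v" by metis
  have "((\<lambda>y. y) has_derivative
      (\<lambda>v. frechet_derivative f (at x) (frechet_derivative ?g (at (f x)) v))) (at (f x))"
    by (rule has_derivative_transform_within_open[OF has_derivative_compose[OF Dg] A(2) fx(1)])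
       (use Df fx(2) in \<open>auto simp: f_inv_into_f\<close>)
  from has_derivative_unique[OF this has_derivative_ident]
  show "frechet_derivative f (at x) (frechet_derivative ?g (at (f x)) w) = w" by metis
qed

text \<open>Replaces the pointwise \<open>inv\<close> in \<open>reversal_lift\<close> by the
  derivative of the inverse map, whose smooth dependence on the base point is known.\<close>

lemma diffeo_on_inv_derivative:
  assumes "diffeo_on A f" "x \<in> A"
  shows "inv (frechet_derivative f (at x)) = frechet_derivative (inv_into A f) (at (f x))"
    and "inv (frechet_derivative (inv_into A f) (at (f x))) = frechet_derivative f (at x)"
proof -
  note D = diffeo_on_derivative_inverse[OF assms]
  show "inv (frechet_derivative f (at x)) = frechet_derivative (inv_into A f) (at (f x))"
    by (rule inv_unique_comp) (simp_all add: D fun_eq_iff)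
  show "inv (frechet_derivative (inv_into A f) (at (f x))) = frechet_derivative f (at x)"
    by (rule inv_unique_comp) (simp_all add: D fun_eq_iff)
qed

section \<open>The lift: smoothness, inverse, derivative and effect on the symplectic form\<close>

lemma smooth_on_bounded_linear_derivative:
  "smooth_on A f \<Longrightarrow> x \<in> A \<Longrightarrow> bounded_linear (frechet_derivative f (at x))"
  using smooth_on_has_derivative has_derivative_bounded_linear by blast

text \<open>This is the shape of the lift, with \<open>g\<close> in the role of the inverse of
  \<open>f\<close>. In a fixed basis the covector component is a finite sum whose coefficients pair
  \<open>p\<close> bilinearly with the directional derivatives \<open>?k i u\<close>, so the product
  and composition rules apply.\<close>

lemma smooth_on_pullback:
  fixes f :: "'a::real_normed_vector \<Rightarrow> 'b::euclidean_space" and g :: "'b \<Rightarrow> 'c::euclidean_space"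
  assumes "open A" "smooth_on A f" "smooth_on B g" "f ` A \<subseteq> B"
  shows "smooth_on (A \<times> UNIV)
    (\<lambda>(u, p :: 'c dual). (f u, - (p o\<^sub>L Blinfun (frechet_derivative g (at (f u))))))"
proof -
  let ?A = "A \<times> (UNIV :: 'c dual set)"
  let ?k = "\<lambda>i u. frechet_derivative g (at (f u)) i"
  have op: "open ?A" using assms(1) by (simp add: open_Times)
  have fstA: "?A = fst -` A" by auto
  have eq: "(case z of (u, p) \<Rightarrow> (f u, - (p o\<^sub>L Blinfun (frechet_derivative g (at (f u)))))) =
      (f (fst z), - (\<Sum>i\<in>Basis. blinfun_apply (snd z) (?k i (fst z)) *\<^sub>R blinfun_inner_right i))"
    if "z \<in> ?A" for z
    using that assms(4) smooth_on_bounded_linear_derivative[OF assms(3)]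
    by (auto simp: blinfun_euclidean_expansion bounded_linear_Blinfun_apply image_subset_iff)
  have f: "Ck_on k A f" for k
    using assms(2) by (simp add: smooth_on_def)
  have k: "Ck_on k A (?k i)" for k i
    using smooth_on_frechet_derivative[OF assms(3)]
    by (intro Ck_on_compose[OF assms(1,4) f, of k "\<lambda>y. frechet_derivative g (at y) i"])
       (simp add: smooth_on_def)
  have C: "Ck_on k ?A (\<lambda>z. (f (fst z),
      - (\<Sum>i\<in>Basis. blinfun_apply (snd z) (?k i (fst z)) *\<^sub>R blinfun_inner_right i)))" for k
  proof (rule Ck_on_Pair[OF op])
    show "Ck_on k ?A (\<lambda>z. f (fst z))"
      unfolding fstA by (intro Ck_on_compose_linear[OF bounded_linear_fst assms(1) f])
    have "Ck_on k ?A (\<lambda>z. ?k i (fst z))" for i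
      unfolding fstA by (intro Ck_on_compose_linear[OF bounded_linear_fst assms(1) k])
    then have "Ck_on k ?A (\<lambda>z. blinfun_apply (snd z) (?k i (fst z)))" for i
      by (intro bounded_bilinear.Ck_on[OF bounded_bilinear_blinfun_apply op]
          Ck_on_bounded_linear[OF bounded_linear_snd op] Ck_on_ident op)
    then show "Ck_on k ?A
        (\<lambda>z. - (\<Sum>i\<in>Basis. blinfun_apply (snd z) (?k i (fst z)) *\<^sub>R blinfun_inner_right i))"
      by (intro Ck_on_bounded_linear[OF bounded_linear_minus[OF bounded_linear_ident] op] Ck_on_sum
          Ck_on_bounded_linear[OF bounded_linear_scaleR_left op] op) auto
  qed
  show ?thesis
    unfolding smooth_on_def
  proof
    fix k
    show "Ck_on k ?A (\<lambda>(u, p). (f u, - (p o\<^sub>L Blinfun (frechet_derivative g (at (f u))))))"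
      by (rule iffD2[OF Ck_on_cong[OF op] C[of k]]) (rule eq)
  qed
qed

lemma reversal_lift_smooth:
  fixes h :: "'a::euclidean_space \<Rightarrow> 'a"
  assumes "diffeo_on H h"
  shows "smooth_on (H \<times> UNIV) (reversal_lift h)"
proof -
  have "smooth_on (H \<times> UNIV)
      (\<lambda>(u, p :: 'a dual).
        (h u, - (p o\<^sub>L Blinfun (frechet_derivative (inv_into H h) (at (h u))))))"
    using assms by (intro smooth_on_pullback[of _ _ "h ` H"]) (auto simp: diffeo_on_def)
  moreover have "open (H \<times> (UNIV :: 'a dual set))"
    using assms by (simp add: diffeo_on_def open_Times)
  ultimately show ?thesis
    by (subst smooth_on_cong)
       (auto simp: reversal_lift_def diffeo_on_inv_derivative(1)[OF assms])
qed

lemma diffeo_on_inverse: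
  assumes "diffeo_on A f"
  shows "diffeo_on (f ` A) (inv_into A f)"
  using assms by (intro diffeo_onI[of _ A _ f]) (auto simp: diffeo_on_def f_inv_into_f)

text \<open>When the lifts of \<open>h\<close> and of its inverse are composed, the two minus signs
  cancel and the two derivatives compose to the identity.\<close>

lemma reversal_lift_diffeo:
  assumes "diffeo_on H h"
  shows "diffeo_on (H \<times> UNIV) (reversal_lift h)"
proof (rule diffeo_onI)
  let ?g = "inv_into H h"
  have H: "open H" "open (h ` H)" "inj_on h H" "smooth_on H h" "smooth_on (h ` H) ?g"
    using assms by (auto simp: diffeo_on_def)
  show "open (H \<times> (UNIV :: 'a dual set))" "open (h ` H \<times> (UNIV :: 'a dual set))"
    using H by (auto intro: open_Times)
  have comp: "Blinfun (frechet_derivative h (at u)) o\<^sub>L Blinfun (frechet_derivative ?g (at (h u))) =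
      id_blinfun"
    "Blinfun (frechet_derivative ?g (at (h u))) o\<^sub>L Blinfun (frechet_derivative h (at u)) =
      id_blinfun" if "u \<in> H" for u
    using diffeo_on_derivative_inverse[OF assms that] that
      smooth_on_bounded_linear_derivative[OF H(4) that]
      smooth_on_bounded_linear_derivative[OF H(5), of "h u"]
    by (auto intro!: blinfun_eqI simp: bounded_linear_Blinfun_apply)
  have comp': "(p o\<^sub>L L) o\<^sub>L M = p o\<^sub>L (L o\<^sub>L M)" for p :: "'a dual" and L M :: "'a \<Rightarrow>\<^sub>L 'a"
    by (rule blinfun_eqI) simp
  have id: "p o\<^sub>L id_blinfun = p" for p :: "'a dual"
    by (rule blinfun_eqI) simp
  note simps = reversal_lift_def bounded_bilinear.minus_left[OF bounded_bilinear_blinfun_compose]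
    comp' comp id
    diffeo_on_inv_derivative[OF assms] H(3)
  show "reversal_lift ?g (reversal_lift h x) = x" if "x \<in> H \<times> UNIV" for x
    using that by (auto simp: simps)
  show "reversal_lift h (reversal_lift ?g y) = y" if "y \<in> h ` H \<times> UNIV" for y
    using that by (auto simp: simps)
  show "smooth_on (H \<times> UNIV) (reversal_lift h)"
    "smooth_on (h ` H \<times> UNIV) (reversal_lift ?g)"
    using assms by (auto intro!: reversal_lift_smooth diffeo_on_inverse)
qed (auto simp: reversal_lift_def inv_into_into)

text \<open>Evaluating the covector component at a fixed \<open>c\<close> makes it real-valued,
  namely - p (Dg(h(u)) c). The product rule for this pairing gives one term from varying
  \<open>p\<close> and, by the chain rule through \<open>h\<close>, one term with D^2 g.\<close>

lemma reversal_lift_derivative: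
  fixes p :: "'a::euclidean_space dual"
  assumes "diffeo_on H h" "u \<in> H"
  defines "g \<equiv> inv_into H h"
  defines "D \<equiv> frechet_derivative (reversal_lift h) (at (u, p))"
  shows "fst (D (a, \<alpha>)) = frechet_derivative h (at u) a" (is ?th1)
    and "snd (D (a, \<alpha>)) c = - \<alpha> (frechet_derivative g (at (h u)) c) -
      p (frechet_derivative (\<lambda>y. frechet_derivative g (at y) c) (at (h u))
        (frechet_derivative h (at u) a))" (is ?th2)
proof -
  have H: "open H" "open (h ` H)" "inj_on h H" "smooth_on H h" "smooth_on (h ` H) g"
    using assms by (auto simp: diffeo_on_def)
  have up: "(u, p) \<in> H \<times> UNIV" and hu: "h u \<in> h ` H" using assms(2) by auto
  have op: "open (H \<times> (UNIV :: 'a dual set))" using H by (auto intro: open_Times)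
  have D: "(reversal_lift h has_derivative D) (at (u, p))"
    unfolding D_def by (rule smooth_on_has_derivative[OF reversal_lift_smooth[OF assms(1)] up])
  have h: "((\<lambda>z. h (fst z)) has_derivative (\<lambda>z. frechet_derivative h (at u) (fst z))) (at (u, p))"
    by (rule has_derivative_compose[of fst fst])
       (use smooth_on_has_derivative[OF H(4) assms(2)]
         in \<open>auto intro!: bounded_linear_imp_has_derivative bounded_linear_fst\<close>)
  have "((\<lambda>z. fst (reversal_lift h z)) has_derivative (\<lambda>z. fst (D z))) (at (u, p))"
    by (intro has_derivative_fst D)
  moreover have "(\<lambda>z. fst (reversal_lift h z)) = (\<lambda>z. h (fst z))"
    by (auto simp: reversal_lift_def)
  ultimately have "(\<lambda>z. fst (D z)) = (\<lambda>z. frechet_derivative h (at u) (fst z))"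
    using has_derivative_unique h by metis
  then show ?th1 by (metis fst_conv)
  let ?k = "\<lambda>y. frechet_derivative g (at y) c"
  have k: "((\<lambda>z. ?k (h (fst z))) has_derivative
      (\<lambda>z. frechet_derivative ?k (at (h u)) (frechet_derivative h (at u) (fst z)))) (at (u, p))"
    by (rule has_derivative_compose[OF h])
       (use smooth_on_has_derivative[OF smooth_on_frechet_derivative[OF H(5)] hu] in simp)
  have "((\<lambda>z. blinfun_apply (snd (reversal_lift h z)) c) has_derivative
      (\<lambda>z. blinfun_apply (snd (D z)) c)) (at (u, p))"
    by (intro bounded_linear.has_derivative[OF blinfun.bounded_linear_left] has_derivative_snd D)
  moreover have "((\<lambda>z. blinfun_apply (snd (reversal_lift h z)) c) has_derivative
      (\<lambda>z :: 'a phase. - (p (frechet_derivative ?k (at (h u)) (frechet_derivative h (at u) (fst z))) +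
        blinfun_apply (snd z) (?k (h u))))) (at (u, p))"
  proof (rule has_derivative_transform_within_open[OF _ op up])
    show "((\<lambda>z :: 'a phase. - (blinfun_apply (snd z) (?k (h (fst z))))) has_derivative
      (\<lambda>z :: 'a phase. - (p (frechet_derivative ?k (at (h u)) (frechet_derivative h (at u) (fst z))) +
        blinfun_apply (snd z) (?k (h u))))) (at (u, p))"
      using blinfun.FDERIV[OF bounded_linear_imp_has_derivative[OF bounded_linear_snd] k]
      by (intro has_derivative_minus) simp
    show "- (blinfun_apply (snd z) (?k (h (fst z)))) = blinfun_apply (snd (reversal_lift h z)) c"
      if "z \<in> H \<times> UNIV" for z :: "'a phase"
      using that smooth_on_bounded_linear_derivative[OF H(5)]
      by (auto simp: reversal_lift_def diffeo_on_inv_derivative(1)[OF assms(1)] g_def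
          bounded_linear_Blinfun_apply blinfun.minus_left)
  qed
  ultimately have "(\<lambda>z. blinfun_apply (snd (D z)) c) =
      (\<lambda>z :: 'a phase. - (p (frechet_derivative ?k (at (h u)) (frechet_derivative h (at u) (fst z))) +
        blinfun_apply (snd z) (?k (h u))))"
    by (rule has_derivative_unique)
  from fun_cong[OF this, of "(a, \<alpha>)"] show ?th2 by simp
qed

lemma reversal_lift_anti_symplectic:
  assumes "diffeo_on H h"
  shows "anti_symplectic_on (H \<times> UNIV) (reversal_lift h)"
  unfolding anti_symplectic_on_def
proof (intro conjI ballI allI)
  show "diffeo_on (H \<times> UNIV) (reversal_lift h)"
    using assms by (rule reversal_lift_diffeo)
next
  fix x a b :: "'a phase"
  assume "x \<in> H \<times> UNIV"
  then obtain u p where x: "x = (u, p)" "u \<in> H" by auto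
  obtain a1 \<alpha> where a: "a = (a1, \<alpha>)" by (cases a)
  obtain b1 \<beta> where b: "b = (b1, \<beta>)" by (cases b)
  let ?g = "inv_into H h" and ?D = "frechet_derivative h (at u)"
  \<comment> \<open>The two halves of \<omega> each contribute a D^2 g term, one with
    \<open>c = ?D b1\<close> and one with \<open>c = ?D a1\<close>. By this symmetry they cancel,
    leaving -(\<alpha>(b1) - \<beta>(a1)).\<close>
  have "frechet_derivative (\<lambda>y. frechet_derivative ?g (at y) (?D a1)) (at (h u)) (?D b1) =
      frechet_derivative (\<lambda>y. frechet_derivative ?g (at y) (?D b1)) (at (h u)) (?D a1)"
    using assms x(2)
    by (intro second_derivative_symmetric[of "h ` H"]) (auto simp: diffeo_on_def smooth_on_def)
  then show "\<omega> (frechet_derivative (reversal_lift h) (at x) a)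
      (frechet_derivative (reversal_lift h) (at x) b) = - \<omega> a b"
    unfolding \<omega>_def a b x(1) reversal_lift_derivative[OF assms x(2)]
    by (simp add: diffeo_on_derivative_inverse[OF assms x(2)])
qed

section \<open>Generating functions and reversal symmetries\<close>

lemma D1_apply:
  assumes "smooth_on W S" "(u, u') \<in> W"
  shows "D1 S u u' a = frechet_derivative S (at (u, u')) (a, 0)"
proof -
  have "((\<lambda>x. S (x, u')) has_derivative (\<lambda>a. frechet_derivative S (at (u, u')) (a, 0))) (at u)"
    by (rule has_derivative_compose[where f = "\<lambda>x. (x, u')" and x = u,
          OF _ smooth_on_has_derivative[OF assms]])
       (auto intro!: derivative_eq_intros)
  then show ?thesis
    unfolding D1_def
    by (metis bounded_linear_Blinfun_apply frechet_derivative_at has_derivative_bounded_linear)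
qed

lemma D2_apply:
  assumes "smooth_on W S" "(u, u') \<in> W"
  shows "D2 S u u' b = frechet_derivative S (at (u, u')) (0, b)"
proof -
  have "((\<lambda>x. S (u, x)) has_derivative (\<lambda>b. frechet_derivative S (at (u, u')) (0, b))) (at u')"
    by (rule has_derivative_compose[where f = "\<lambda>x. (u, x)" and x = u',
          OF _ smooth_on_has_derivative[OF assms]])
       (auto intro!: derivative_eq_intros)
  then show ?thesis
    unfolding D2_def
    by (metis bounded_linear_Blinfun_apply frechet_derivative_at has_derivative_bounded_linear)
qed

lemma has_derivative_D1_D2:
  assumes "smooth_on W S" "(u, u') \<in> W"
  shows "(S has_derivative (\<lambda>(a, b). D1 S u u' a + D2 S u u' b)) (at (u, u'))"
proof -
  have D: "(S has_derivative frechet_derivative S (at (u, u'))) (at (u, u'))"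
    by (rule smooth_on_has_derivative[OF assms])
  have "frechet_derivative S (at (u, u')) (a, b) = D1 S u u' a + D2 S u u' b" for a b
    using linear_add[OF has_derivative_linear[OF D], of "(a, 0)" "(0, b)"]
    by (simp add: D1_apply[OF assms] D2_apply[OF assms])
  then have "frechet_derivative S (at (u, u')) = (\<lambda>(a, b). D1 S u u' a + D2 S u u' b)"
    by auto
  with D show ?thesis by simp
qed

text \<open>Operator-norm continuity reduces to values on basis vectors, and these are directional
  derivatives of \<open>S\<close>. It makes the point \<phi>(v) depend continuously on (u,
  u').\<close>

lemma continuous_on_D2:
  assumes "smooth_on W S"
  shows "continuous_on W (\<lambda>z. D2 S (fst z) (snd z))"
proof (rule continuous_on_blinfun_componentwise)
  fix i :: 'a
  have "continuous_on W (\<lambda>z. frechet_derivative S (at z) (0, i))"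
    by (intro smooth_on_imp_continuous_on smooth_on_frechet_derivative assms)
  then show "continuous_on W (\<lambda>z. D2 S (fst z) (snd z) i)"
    by (rule continuous_on_eq) (auto simp: D2_apply[OF assms])
qed

lemma generating_functionD:
  assumes "generating_function W S A \<phi>"
  shows "(u, u') \<in> W \<Longrightarrow> (u, D1 S u u') \<in> A"
    and "(u, u') \<in> W \<Longrightarrow> \<phi> (u, D1 S u u') = (u', - D2 S u u')"
    and "\<lbrakk>(u, p) \<in> A; \<phi> (u, p) = (u', q)\<rbrakk> \<Longrightarrow> (u, u') \<in> W \<and> p = D1 S u u' \<and> q = - D2 S u u'"
proof -
  have eq: "{(v, \<phi> v) | v. v \<in> A} = {((u, D1 S u u'), (u', - D2 S u u')) | u u'. (u, u') \<in> W}"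
    using assms by (simp add: generating_function_def)
  {
    assume "(u, u') \<in> W"
    then have "((u, D1 S u u'), (u', - D2 S u u')) \<in> {(v, \<phi> v) | v. v \<in> A}"
      unfolding eq by blast
    then show "(u, D1 S u u') \<in> A" "\<phi> (u, D1 S u u') = (u', - D2 S u u')" by auto
  next
    assume "(u, p) \<in> A" "\<phi> (u, p) = (u', q)"
    then have "((u, p), (u', q)) \<in> {(v, \<phi> v) | v. v \<in> A}" by auto
    then show "(u, u') \<in> W \<and> p = D1 S u u' \<and> q = - D2 S u u'"
      unfolding eq by auto
  }
qed

text \<open>For $R = h \mathbin{\underline\times} h$ this says $d(S \circ R) = dS$ at $(u, u')$, with the
  derivative of $h$ moved to the right-hand side.\<close>

definition reversal_critical ::
  "('a::euclidean_space \<times> 'a) set \<Rightarrow> ('a \<times> 'a \<Rightarrow> real) \<Rightarrow> 'a set \<Rightarrow> ('a \<Rightarrow> 'a) \<Rightarrow> 'a \<times> 'a \<Rightarrow> bool" where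
  "reversal_critical W S H h = (\<lambda>(u, u'). (u, u') \<in> W \<and> u \<in> H \<and> u' \<in> H \<and> (h u', h u) \<in> W \<and>
     D1 S (h u') (h u) = D2 S u u' o\<^sub>L Blinfun (inv (frechet_derivative h (at u'))) \<and>
     D2 S (h u') (h u) = D1 S u u' o\<^sub>L Blinfun (inv (frechet_derivative h (at u))))"

section \<open>Invariance of \<open>S\<close> under the reversal action, and the reversal
  symmetry\<close>

lemma reversal_action_has_derivative:
  assumes "smooth_on H h" "u \<in> H" "u' \<in> H"
  shows "(reversal_action h has_derivative
    (\<lambda>(a, b). (frechet_derivative h (at u') b, frechet_derivative h (at u) a))) (at (u, u'))"
proof -
  have "((\<lambda>z. h (snd z)) has_derivative (\<lambda>z. frechet_derivative h (at u') (snd z))) (at (u, u'))"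
    by (rule has_derivative_compose[where f = snd and x = "(u, u')"])
       (use smooth_on_has_derivative[OF assms(1,3)]
         in \<open>auto intro!: bounded_linear_imp_has_derivative bounded_linear_snd\<close>)
  moreover have "((\<lambda>z. h (fst z)) has_derivative (\<lambda>z. frechet_derivative h (at u) (fst z)))
      (at (u, u'))"
    by (rule has_derivative_compose[where f = fst and x = "(u, u')"])
       (use smooth_on_has_derivative[OF assms(1,2)]
         in \<open>auto intro!: bounded_linear_imp_has_derivative bounded_linear_fst\<close>)
  ultimately show ?thesis
    using has_derivative_Pair by (fastforce simp: reversal_action_def case_prod_unfold)
qed

lemma has_derivative_reversal_action:
  assumes "smooth_on W S" "smooth_on H h" "u \<in> H" "u' \<in> H" "(h u', h u) \<in> W"
  shows "((\<lambda>z. S (reversal_action h z)) has_derivative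
    (\<lambda>(a, b). D1 S (h u') (h u) (frechet_derivative h (at u') b) +
      D2 S (h u') (h u) (frechet_derivative h (at u) a))) (at (u, u'))"
proof -
  have "reversal_action h (u, u') = (h u', h u)" by (simp add: reversal_action_def)
  then show ?thesis
    using has_derivative_compose[OF reversal_action_has_derivative[OF assms(2-4)], of S]
      has_derivative_D1_D2[OF assms(1,5)]
    by (fastforce simp: case_prod_unfold)
qed

text \<open>Forwards, the difference of \<open>S\<close> after the reversal action and
  \<open>S\<close> has zero derivative on a ball, which is convex, so it is constant there.
  Backwards, the identity is differentiated at every point near 0 and the two directions are
  separated.\<close>

lemma reversal_critical_iff:
  assumes "smooth_on W S" "diffeo_on H h"
  shows "(\<forall>\<^sub>F z in nhds 0. reversal_critical W S H h z) \<longleftrightarrow>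
    (\<exists>c. \<forall>\<^sub>F z in nhds 0. z \<in> W \<and> z \<in> H \<times> H \<and> reversal_action h z \<in> W \<and>
      S (reversal_action h z) = S z + c)" (is "?L \<longleftrightarrow> ?R")
proof
  note h = assms(2)[unfolded diffeo_on_def]
  \<comment> \<open>\<open>Blinfun\<close> evaluates to its argument only for bounded linear maps,
    so this must be secured for the inverse derivatives.\<close>
  have bl: "bounded_linear (inv (frechet_derivative h (at u)))" if "u \<in> H" for u
    using h that diffeo_on_inv_derivative(1)[OF assms(2) that]
      smooth_on_bounded_linear_derivative[of "h ` H"] by auto
  note inv = diffeo_on_inv_derivative[OF assms(2)] diffeo_on_derivative_inverse[OF assms(2)]
  {
    assume ?L
    then obtain d where d: "d > 0" "\<And>z. dist z 0 < d \<Longrightarrow> reversal_critical W S H h z"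
      unfolding eventually_nhds_metric by blast
    let ?T = "\<lambda>z. S (reversal_action h z) - S z"
    have der: "(?T has_derivative (\<lambda>_. 0)) (at z within ball 0 d)" if z: "z \<in> ball 0 d" for z
    proof -
      obtain u u' where zu: "z = (u, u')" by (cases z)
      have R: "reversal_critical W S H h (u, u')"
        using d(2)[of z] z zu by (simp add: dist_commute)
      then have m: "(u, u') \<in> W" "u \<in> H" "u' \<in> H" "(h u', h u) \<in> W"
        and e: "D1 S (h u') (h u) = D2 S u u' o\<^sub>L Blinfun (inv (frechet_derivative h (at u')))"
          "D2 S (h u') (h u) = D1 S u u' o\<^sub>L Blinfun (inv (frechet_derivative h (at u)))"
        by (auto simp: reversal_critical_def)
      have "D1 S (h u') (h u) (frechet_derivative h (at u') b) = D2 S u u' b"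
        "D2 S (h u') (h u) (frechet_derivative h (at u) a) = D1 S u u' a" for a b
        unfolding e using bl m(2,3) by (simp_all add: bounded_linear_Blinfun_apply inv)
      then have "(?T has_derivative (\<lambda>_. 0)) (at (u, u'))"
        using has_derivative_diff[OF has_derivative_reversal_action[OF assms(1) _ m(2-4)]
            has_derivative_D1_D2[OF assms(1) m(1)]] h
        by (simp add: case_prod_unfold)
      then show ?thesis
        unfolding zu by (rule has_derivative_at_withinI)
    qed
    obtain c where c: "\<And>z. z \<in> ball 0 d \<Longrightarrow> ?T z = c"
      using has_derivative_zero_constant[OF convex_ball der] by meson
    have "z \<in> W \<and> z \<in> H \<times> H \<and> reversal_action h z \<in> W \<and> S (reversal_action h z) = S z + c"
      if "dist z 0 < d" for z
      using d(2)[OF that] c[of z] that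
      by (auto simp: reversal_critical_def reversal_action_def dist_commute algebra_simps)
    then show ?R
      using d(1) unfolding eventually_nhds_metric by blast
  next
    assume ?R
    then obtain c where c: "\<forall>\<^sub>F z in nhds 0. z \<in> W \<and> z \<in> H \<times> H \<and> reversal_action h z \<in> W \<and>
      S (reversal_action h z) = S z + c" by blast
    \<comment> \<open>A property holding near 0 holds in a neighbourhood of each point near 0, so
      the equation may be differentiated at \<open>z'\<close>.\<close>
    then have "\<forall>\<^sub>F z' in nhds 0. \<forall>\<^sub>F z in nhds z'. z \<in> W \<and> z \<in> H \<times> H \<and> reversal_action h z \<in> W \<and>
      S (reversal_action h z) = S z + c" by (simp add: eventually_eventually)
    then show ?L
    proof (rule eventually_mono)
      fix z' assume ev: "\<forall>\<^sub>F z in nhds z'. z \<in> W \<and> z \<in> H \<times> H \<and> reversal_action h z \<in> W \<and>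
        S (reversal_action h z) = S z + c"
      obtain u u' where z': "z' = (u, u')" by (cases z')
      from eventually_nhds_x_imp_x[OF ev]
      have m: "(u, u') \<in> W" "u \<in> H" "u' \<in> H" "(h u', h u) \<in> W"
        by (auto simp: z' reversal_action_def)
      have "\<forall>\<^sub>F z in nhds (u, u'). S (reversal_action h z) - c = S z"
        using ev unfolding z' by eventually_elim simp
      then obtain N where N: "open N" "(u, u') \<in> N" "\<And>z. z \<in> N \<Longrightarrow> S (reversal_action h z) - c = S z"
        unfolding eventually_nhds by blast
      have "((\<lambda>z. S (reversal_action h z) - c) has_derivative
          (\<lambda>(a, b). D1 S (h u') (h u) (frechet_derivative h (at u') b) +
            D2 S (h u') (h u) (frechet_derivative h (at u) a))) (at (u, u'))"
        using has_derivative_diff[OF has_derivative_reversal_action[OF assms(1) _ m(2-4)]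
          has_derivative_const] h by simp
      from has_derivative_transform_within_open[OF this N]
      have "(S has_derivative (\<lambda>(a, b). D1 S (h u') (h u) (frechet_derivative h (at u') b) +
            D2 S (h u') (h u) (frechet_derivative h (at u) a))) (at (u, u'))" .
      from has_derivative_unique[OF this has_derivative_D1_D2[OF assms(1) m(1)]]
      have eq: "D1 S (h u') (h u) (frechet_derivative h (at u') b) +
          D2 S (h u') (h u) (frechet_derivative h (at u) a) = D1 S u u' a + D2 S u u' b" for a b
        by (simp add: fun_eq_iff)
      have lin0: "frechet_derivative h (at v) 0 = 0" if "v \<in> H" for v
        using linear_0[OF has_derivative_linear[OF smooth_on_has_derivative[of H h]]] h that
        by blast
      \<comment> \<open>The choice a = 0 and b = Dh(u')^{-1} w in \<open>eq\<close> isolates the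
        first condition; b = 0 and a = Dh(u)^{-1} w isolates the second. In \<open>eq\<close> the
        variable \<open>b\<close> occurs first, hence the order of the instantiations.\<close>
      have "D1 S (h u') (h u) = D2 S u u' o\<^sub>L Blinfun (inv (frechet_derivative h (at u')))"
      proof (rule blinfun_eqI)
        fix w
        show "D1 S (h u') (h u) w = (D2 S u u' o\<^sub>L Blinfun (inv (frechet_derivative h (at u')))) w"
          using eq[of "inv (frechet_derivative h (at u')) w" 0] bl[OF m(3)] m
          by (simp add: bounded_linear_Blinfun_apply inv lin0)
      qed
      moreover have "D2 S (h u') (h u) = D1 S u u' o\<^sub>L Blinfun (inv (frechet_derivative h (at u)))"
      proof (rule blinfun_eqI)
        fix w
        show "D2 S (h u') (h u) w = (D1 S u u' o\<^sub>L Blinfun (inv (frechet_derivative h (at u)))) w"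
          using eq[of 0 "inv (frechet_derivative h (at u)) w"] bl[OF m(2)] m
          by (simp add: bounded_linear_Blinfun_apply inv lin0)
      qed
      ultimately show "reversal_critical W S H h z'"
        using m by (simp add: z' reversal_critical_def)
    qed
  }
qed

text \<open>The lift sends \<phi>(v) to (h u', X), its sign cancelling that of - D2 S, and sends v
  to (h u, - Y). The pair of these points lies on the graph of \<phi> exactly when (h u', h u)
  belongs to \<open>W\<close> and has partial derivatives X and Y.\<close>

lemma reversal_critical_iff_lift:
  assumes "generating_function W S A \<phi>" "(u, u') \<in> W" "u \<in> H" "u' \<in> H"
  shows "reversal_critical W S H h (u, u') \<longleftrightarrow>
    reversal_lift h (u', - D2 S u u') \<in> A \<and>
    \<phi> (reversal_lift h (u', - D2 S u u')) = reversal_lift h (u, D1 S u u')"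
proof -
  note gen = generating_functionD[OF assms(1)]
  define X where "X = D2 S u u' o\<^sub>L Blinfun (inv (frechet_derivative h (at u')))"
  define Y where "Y = D1 S u u' o\<^sub>L Blinfun (inv (frechet_derivative h (at u)))"
  have lift: "reversal_lift h (u', - D2 S u u') = (h u', X)"
    "reversal_lift h (u, D1 S u u') = (h u, - Y)"
    by (simp_all add: reversal_lift_def X_def Y_def
        bounded_bilinear.minus_left[OF bounded_bilinear_blinfun_compose])
  have "reversal_critical W S H h (u, u') \<longleftrightarrow>
      (h u', h u) \<in> W \<and> D1 S (h u') (h u) = X \<and> D2 S (h u') (h u) = Y"
    using assms(2-4) by (simp add: reversal_critical_def X_def Y_def)
  also have "\<dots> \<longleftrightarrow> (h u', X) \<in> A \<and> \<phi> (h u', X) = (h u, - Y)"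
    using gen(1,2)[of "h u'" "h u"] gen(3)[of "h u'" X "h u" "- Y"] neg_equal_iff_equal by metis
  finally show ?thesis
    unfolding lift .
qed

lemma continuous_on_tendsto_nhds:
  fixes f :: "'a::t2_space \<Rightarrow> 'b::topological_space"
  assumes "continuous_on A f" "open A" "x \<in> A"
  shows "(f \<longlongrightarrow> f x) (nhds x)"
proof -
  have "isCont f x"
    using assms continuous_on_eq_continuous_at by blast
  then show ?thesis
    unfolding isCont_def by (rule tendsto_at_iff_tendsto_nhds[THEN iffD1])
qed

text \<open>The bound point of \<open>reversal_symmetry\<close> is taken as w = \<phi>(v), while
  criticality is stated in the coordinates z = (u, u'). Each neighbourhood statement is carried to
  the other along a continuous map sending 0 to 0.\<close>

lemma reversal_symmetry_iff:
  assumes "0 \<in> A" "symplectic_on A \<phi>" "\<phi> 0 = 0" "generating_function W S A \<phi>" "0 \<in> H" "diffeo_on H h"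
  shows "reversal_symmetry (H \<times> UNIV) (reversal_lift h) A \<phi> \<longleftrightarrow>
    (\<forall>\<^sub>F z in nhds 0. reversal_critical W S H h z)"
proof
  let ?\<Psi> = "reversal_lift h" and ?C = "H \<times> (UNIV :: 'a dual set)"
  note gen = generating_functionD[OF assms(4)]
  have \<phi>: "open A" "open (\<phi> ` A)" "inj_on \<phi> A" "smooth_on (\<phi> ` A) (inv_into A \<phi>)"
    using assms(2) by (auto simp: symplectic_on_def diffeo_on_def)
  have W: "open W" "smooth_on W S" using assms(4) by (auto simp: generating_function_def)
  have H: "open H" using assms(6) by (simp add: diffeo_on_def)
  \<comment> \<open>The origin is a fixed point of \<phi>, so (0, 0) lies on its graph; this makes
    the coordinate change below send 0 to 0.\<close>
  have W0: "(0, 0) \<in> W" "D2 S 0 0 = 0"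
    using gen(3)[of 0 0 0 0] assms(1,3) by (auto simp: zero_prod_def)
  have inj: "inj_on ?\<Psi> ?C"
    using reversal_lift_diffeo[OF assms(6)] by (simp add: diffeo_on_def)
  have evW: "\<forall>\<^sub>F z in nhds 0. z \<in> W \<and> z \<in> H \<times> H"
    using eventually_nhds_in_open[of "W \<inter> H \<times> H" 0] W(1) W0(1) H assms(5)
    by (auto simp: zero_prod_def open_Times open_Int)
  {
    assume "reversal_symmetry ?C ?\<Psi> A \<phi>"
    then have ev: "\<forall>\<^sub>F v in nhds 0. v \<in> ?C \<and> ?\<Psi> v \<in> A \<and> \<phi> (?\<Psi> v) \<in> ?\<Psi> ` ?C \<and> v \<in> \<phi> ` A \<and>
        inv_into ?C ?\<Psi> (\<phi> (?\<Psi> v)) = inv_into A \<phi> v"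
      by (simp add: reversal_symmetry_def)
    \<comment> \<open>This is the passage from z = (u, u') to w = \<phi>(v).\<close>
    have "continuous_on W (\<lambda>z. (snd z, - D2 S (fst z) (snd z)))"
      by (intro continuous_intros continuous_on_D2 W)
    from continuous_on_tendsto_nhds[OF this W(1) W0(1)]
    have "filterlim (\<lambda>z. (snd z, - D2 S (fst z) (snd z))) (nhds 0) (nhds 0)"
      by (simp add: W0(2) zero_prod_def)
    from eventually_compose_filterlim[OF ev this] evW
    show "\<forall>\<^sub>F z in nhds 0. reversal_critical W S H h z"
    proof eventually_elim
      case (elim z)
      obtain u u' where z: "z = (u, u')" by (cases z)
      have m: "(u, u') \<in> W" "u \<in> H" "u' \<in> H" using elim(2) z by auto
      let ?w = "(u', - D2 S u u')" and ?v = "(u, D1 S u u')"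
      have *: "?\<Psi> ?w \<in> A" "\<phi> (?\<Psi> ?w) \<in> ?\<Psi> ` ?C" "inv_into ?C ?\<Psi> (\<phi> (?\<Psi> ?w)) = inv_into A \<phi> ?w"
        using elim(1) z by auto
      have "inv_into A \<phi> ?w = ?v"
        using inv_into_f_eq[OF \<phi>(3) gen(1,2)[OF m(1)]] .
      \<comment> \<open>Apply \<Psi> to both sides; the membership of \<phi>(\<Psi>(w)) in the image
        of \<Psi> makes \<open>inv_into\<close> a genuine preimage.\<close>
      then have "\<phi> (?\<Psi> ?w) = ?\<Psi> ?v"
        using f_inv_into_f[OF *(2)] *(3) by simp
      then show ?case
        using reversal_critical_iff_lift[OF assms(4) m] *(1) z by simp
    qed
  next
    assume L: "\<forall>\<^sub>F z in nhds 0. reversal_critical W S H h z"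
    have 0: "0 \<in> \<phi> ` A" "inv_into A \<phi> 0 = 0"
      using assms(1,3) \<phi>(3) by (auto intro: rev_image_eqI inv_into_f_eq)
    \<comment> \<open>This is the reverse passage from w to (u, u'), reading \<open>u\<close> off
      the preimage v and \<open>u'\<close> off w itself.\<close>
    have "continuous_on (\<phi> ` A) (\<lambda>w. (fst (inv_into A \<phi> w), fst w))"
      by (intro continuous_intros smooth_on_imp_continuous_on \<phi>)
    from continuous_on_tendsto_nhds[OF this \<phi>(2) 0(1)]
    have lim: "filterlim (\<lambda>w. (fst (inv_into A \<phi> w), fst w)) (nhds 0) (nhds 0)"
      unfolding 0(2) by (simp add: zero_prod_def)
    have "\<forall>\<^sub>F w in nhds 0. w \<in> ?C \<and> ?\<Psi> w \<in> A \<and> \<phi> (?\<Psi> w) \<in> ?\<Psi> ` ?C \<and> w \<in> \<phi> ` A \<and>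
        inv_into ?C ?\<Psi> (\<phi> (?\<Psi> w)) = inv_into A \<phi> w"
      using eventually_compose_filterlim[OF L lim] eventually_nhds_in_open[OF \<phi>(2) 0(1)]
    proof eventually_elim
      case (elim w)
      obtain u p where v: "inv_into A \<phi> w = (u, p)" by (cases "inv_into A \<phi> w")
      obtain u' q where w: "w = (u', q)" by (cases w)
      have vA: "(u, p) \<in> A" "\<phi> (u, p) = (u', q)"
        using inv_into_into[OF elim(2)] f_inv_into_f[OF elim(2)] v w by auto
      have g: "(u, u') \<in> W" "p = D1 S u u'" "q = - D2 S u u'"
        using gen(3)[OF vA] by auto
      have m: "u \<in> H" "u' \<in> H"
        using elim(1) v w by (auto simp: reversal_critical_def)
      have *: "?\<Psi> w \<in> A" "\<phi> (?\<Psi> w) = ?\<Psi> (u, p)"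
        using elim(1) reversal_critical_iff_lift[OF assms(4) g(1) m] v w g by auto
      have "inv_into ?C ?\<Psi> (?\<Psi> (u, p)) = (u, p)"
        using inj m by (intro inv_into_f_f) auto
      then show ?case
        using * elim(2) m v w by auto
    qed
    then show "reversal_symmetry ?C ?\<Psi> A \<phi>"
      using reversal_lift_anti_symplectic[OF assms(6)] by (simp add: reversal_symmetry_def)
  }
qed

theorem proposition3p10:
  fixes \<phi> :: "'a::euclidean_space phase \<Rightarrow> 'a phase"
    and S :: "'a \<times> 'a \<Rightarrow> real"
    and h :: "'a \<Rightarrow> 'a"
    and A :: "'a phase set" and W :: "('a \<times> 'a) set" and H :: "'a set"
  assumes "0 \<in> A" and "symplectic_on A \<phi>" and "\<phi> 0 = 0"
    and "generating_function W S A \<phi>"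
    and "0 \<in> H" and "diffeo_on H h"
  shows "anti_symplectic_on (H \<times> UNIV) (reversal_lift h) \<and>
    (reversal_symmetry (H \<times> UNIV) (reversal_lift h) A \<phi> \<longleftrightarrow>
     (\<exists>c. \<forall>\<^sub>F z in nhds 0.
        z \<in> W \<and> z \<in> H \<times> H \<and> reversal_action h z \<in> W \<and>
        S (reversal_action h z) = S z + c))"
  using reversal_lift_anti_symplectic[OF assms(6)] reversal_symmetry_iff[OF assms]
    reversal_critical_iff[OF _ assms(6)] assms(4)
  by (simp add: generating_function_def)

end
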